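(* Let $(A,\omega)$ be a commutative baric $K$-algebra satisfying $2x^{2}x^{4}=\omega(x)^{2}x^{4}+\omega(x)^{4}x^{2}$ for all $x\in A$, with Peirce decomposition $A=Ke\oplus A_0\oplus A_{\frac12}\oplus A_{\lambda}\oplus A_{\bar\lambda}$ relative to a non-zero idempotent $e$. (i) If $A_0=A_{\bar\lambda}=0$, then $A$ satisfies $x^3-(1+\lambda)\omega(x)x^2+\lambda\omega(x)^2x=0$ for all $x\in A$. (ii) If $A_0=A_{\lambda}=0$, then $A$ satisfies $x^3-(1+\bar\lambda)\omega(x)x^2+\bar\lambda\omega(x)^2x=0$ for all $x\in A$.
   Context: $K$ is an algebraically closed (infinite, commutative) field of characteristic different from $2$. Algebras are commutative but not necessarily associative. A baric $K$-algebra $(A,\omega)$ is a $K$-algebra $A$ with a non-zero algebra homomorphism $\omega:A\to K$. Principal powers are $x^1=x$, $x^{k+1}=x\,x^{k}$. Here $\lambda=\frac{-1-i\sqrt{23}}{4}$, $\bar\lambda=\frac{-1+i\sqrt{23}}{4}$, where $i\sqrt{23}$ denotes a fixed square root of $-23$ in $K$, and for an idempotent $e$, $A_\alpha=\{x\in\ker\omega: ex=\alpha x\}$ for $\alpha\in\{0,\frac12,\lambda,\bar\lambda\}$.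
   Formalization: Characteristic 163 of K is excluded in addition to 2: there 23/6 equals λ or λ̄, and the algebra with basis e, v, w and ee=e, ev=(23/6)v, ew=(23/6)w, vv=w satisfies all hypotheses but violates the cubic identity of (i) or (ii). *)

theory Defs
  imports "HOL-Computational_Algebra.Computational_Algebra"
begin

text \<open>Algebras are neither assumed associative nor unital nor finite-dimensional.\<close>

locale comm_nonassoc_algebra = vector_space scale
  for scale :: "'k::field \<Rightarrow> 'a::ab_group_add \<Rightarrow> 'a" +
  fixes mul :: "'a \<Rightarrow> 'a \<Rightarrow> 'a"
  assumes mult_commute: "mul x y = mul y x"
    and mult_add_left: "mul (x + y) z = mul x z + mul y z"
    and mult_scale_left: "mul (scale c x) y = scale c (mul x y)"

locale comm_baric_algebra = comm_nonassoc_algebra scale mul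
  for scale :: "'k::field \<Rightarrow> 'a::ab_group_add \<Rightarrow> 'a" and mul :: "'a \<Rightarrow> 'a \<Rightarrow> 'a" +
  fixes \<omega> :: "'a \<Rightarrow> 'k"
  assumes weight_linear: "Vector_Spaces.linear scale (*) \<omega>"
    and weight_mult: "\<omega> (mul x y) = \<omega> x * \<omega> y"
    and weight_nonzero: "\<exists>x. \<omega> x \<noteq> 0"

text \<open>Principal powers are only meaningful for positive exponents; the value at \<open>0\<close> is a dummy.\<close>

fun ppow :: "('a \<Rightarrow> 'a \<Rightarrow> 'a) \<Rightarrow> 'a \<Rightarrow> nat \<Rightarrow> 'a" where
  "ppow mul x 0 = x"
| "ppow mul x (Suc 0) = x"
| "ppow mul x (Suc (Suc k)) = mul x (ppow mul x (Suc k))"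

definition peirce_space ::
  "('k \<Rightarrow> 'a \<Rightarrow> 'a) \<Rightarrow> ('a \<Rightarrow> 'a \<Rightarrow> 'a) \<Rightarrow> ('a \<Rightarrow> 'k::zero) \<Rightarrow> 'a \<Rightarrow> 'k \<Rightarrow> 'a set" where
  "peirce_space scale mul \<omega> e \<alpha> = {x. \<omega> x = 0 \<and> mul e x = scale \<alpha> x}"

text \<open>The whole type is the internal direct sum of a finite list of subspaces. A list rather than
  a set, so that a nonzero subspace occurring twice does violate directness (for instance
  \<open>A\<^sub>\<lambda>\<close> when both Peirce roots coincide).\<close>

definition internal_direct_sum :: "'a::monoid_add set list \<Rightarrow> bool" where
  "internal_direct_sum Vs \<longleftrightarrow>
     (\<forall>x. \<exists>!xs. list_all2 (\<lambda>v V. v \<in> V) xs Vs \<and> sum_list xs = x)"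

text \<open>The roots of \<open>2 t\<^sup>2 + t + 3\<close>, where \<open>r\<close> is the chosen square root of \<open>-23\<close>.\<close>

definition peirce_lambda :: "'k::field \<Rightarrow> 'k" where
  "peirce_lambda r = (-1 - r) / 4"

definition peirce_lambda_bar :: "'k::field \<Rightarrow> 'k" where
  "peirce_lambda_bar r = (-1 + r) / 4"

text \<open>Characteristic \<open>163\<close> has to be excluded from the statement along with \<open>2\<close>. There
  \<open>23/6\<close> is a root of \<open>2 t\<^sup>2 + t + 3\<close>, hence equal to \<open>\<lambda>\<close> or to its conjugate, whichever \<open>r\<close> is chosen. Write \<open>\<mu>\<close> for
  it; the commutative algebra with basis \<open>e, v, w\<close> and nonzero products \<open>e e = e\<close>,
  \<open>e v = \<mu> v\<close>, \<open>e w = \<mu> w\<close>, \<open>v v = w\<close>, with weight \<open>\<omega>(e) = 1\<close>, \<open>\<omega>(v) = \<omega>(w) = 0\<close>,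
  satisfies the degree-six identity and has Peirce decomposition \<open>K e \<oplus> A\<^sub>\<mu>\<close>, but
  \<open>x = e + v\<close> violates \<open>x\<^sup>3 - (1 + \<mu>) \<omega>(x) x\<^sup>2 + \<mu> \<omega>(x)\<^sup>2 x = 0\<close>.\<close>

end

theory Submission
  imports Defs
begin

text \<open>Let \<open>\<mu>\<close> be the one of the two roots of \<open>2 t\<^sup>2 + t + 3\<close> whose Peirce space survives, and write
  \<open>H\<close> for the Peirce space of \<open>1/2\<close> and \<open>M\<close> for that of \<open>\<mu>\<close>, so that every element is
  \<open>x = c e + u + v\<close> with \<open>c = \<omega>(x)\<close>, \<open>u \<in> H\<close>, \<open>v \<in> M\<close>. Both cases of the theorem are the same
  statement about \<open>\<mu>\<close>. If the multiplication obeys \<open>u\<^sup>2 \<in> M\<close>, \<open>u v \<in> H\<close>, \<open>M\<^sup>2 = 0\<close>, and all of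
  \<open>u u\<^sup>2\<close>, \<open>u (u v)\<close>, \<open>v (u v)\<close> vanish, then multiplying out \<open>x\<^sup>3 - (1 + \<mu>) c x\<^sup>2 + \<mu> c\<^sup>2 x\<close> leaves
  no term at all (\<open>principal_train_equation\<close>). So the work is to establish these product rules.

  They come from inserting \<open>e + s y\<close> with \<open>\<omega>(y) = 0\<close> into the degree-six identity. The result is a
  polynomial in \<open>s\<close> with vector coefficients; as the field is infinite, each coefficient vanishes,
  and the coefficients of \<open>s\<^sup>2\<close> and \<open>s\<^sup>3\<close> suffice (\<open>homogeneous_parts\<close>). Taking
  \<open>y = u\<close>, \<open>y = v\<close> and \<open>y = u + v\<close> and separating the two Peirce components gives one scalar equation
  for each unwanted component:

  \<^item> degree two: \<open>2 a = 0\<close> for the \<open>H\<close>-part \<open>a\<close> of \<open>u\<^sup>2\<close>; \<open>- 8 \<mu>\<^sup>2 a = 0\<close> and \<open>(23 - 6 \<mu>) b = 0\<close> for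
    the two parts of \<open>v\<^sup>2\<close>; \<open>\<mu> (2 \<mu> - 1) (4 \<mu> + 1) b = 0\<close> for the \<open>M\<close>-part of \<open>u v\<close>;
  \<^item> degree three: \<open>(\<mu> + 1) u u\<^sup>2 = 0\<close>, \<open>4 \<mu> (\<mu> - 3) v (u v) = 0\<close> and \<open>2 (\<mu> + 6) u (u v) = 0\<close>.

  A root \<open>\<mu>\<close> of \<open>2 t\<^sup>2 + t + 3\<close> can annihilate one of these scalars only in small positive
  characteristic. The factor \<open>23 - 6 \<mu>\<close> forces characteristic \<open>2\<close> or \<open>163\<close>. The scalars \<open>2 \<mu> - 1\<close>
  and \<open>\<mu> + 1\<close> never vanish in characteristic other than \<open>2\<close>. The remaining ones force
  \<open>\<mu> = 0\<close> (characteristic \<open>3\<close>, where \<open>M\<close> is the Peirce space of \<open>0\<close>) or \<open>4 \<mu> + 1 = 0\<close>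
  (characteristic \<open>23\<close>, where \<open>\<lambda>\<close> and its conjugate coincide), and in both situations \<open>M = 0\<close>.\<close>

section \<open>Linear functionals and polynomials with vector coefficients\<close>

lemma infinite_UNIV_alg_closed_field: "infinite (UNIV :: 'k::alg_closed_field set)"
proof
  assume fin: "finite (UNIV :: 'k set)"
  define q :: "'k poly" where "q = (\<Prod>a\<in>UNIV. [:-a, 1:]) + 1"
  have "degree (\<Prod>a\<in>(UNIV::'k set). [:-a, 1:]) = card (UNIV :: 'k set)"
    by (subst degree_prod_eq_sum_degree) auto
  then have "degree q > 0"
    unfolding q_def using fin by (subst degree_add_eq_left) (auto simp: card_gt_0_iff)
  then obtain x where "poly q x = 0"
    using alg_closed_imp_poly_has_root by blast
  moreover have "poly q x = 1"
    using fin by (auto simp: q_def poly_prod intro!: prod_zero)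
  ultimately show False by simp
qed

context vector_space
begin

text \<open>Since functionals separate points, an identity between vectors can be checked after applying
  an arbitrary functional, where it becomes an identity in a commutative ring and Groebner bases
  apply. All expansions of nonassociative products below are verified this way.\<close>

lemma vector_eqI:
  assumes "\<And>\<phi>. Vector_Spaces.linear scale (*) \<phi> \<Longrightarrow> \<phi> x = \<phi> y"
  shows "x = y"
proof (rule ccontr)
  assume "x \<noteq> y"
  interpret field_space: vector_space "(*) :: 'a \<Rightarrow> 'a \<Rightarrow> 'a"
    by unfold_locales (simp_all add: algebra_simps)
  interpret pair: vector_space_pair scale "(*) :: 'a \<Rightarrow> 'a \<Rightarrow> 'a"
    by unfold_locales
  have "independent {x - y}"
    using \<open>x \<noteq> y\<close> by simp
  then obtain \<phi> where lin: "Vector_Spaces.linear scale (*) \<phi>" and one: "\<phi> (x - y) = 1"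
    using pair.linear_independent_extend[of "{x - y}" "\<lambda>_. 1"] by auto
  interpret \<phi>: Vector_Spaces.linear scale "(*)" \<phi> by (fact lin)
  show False
    using assms[OF lin] one by (simp add: \<phi>.diff)
qed

lemma coefficients_vanish:
  fixes a :: "nat \<Rightarrow> 'b"
  assumes inf: "infinite (UNIV :: 'a set)"
    and zero: "\<And>s. (\<Sum>i\<le>n. scale (s ^ i) (a i)) = 0"
    and i: "i \<le> n"
  shows "a i = 0"
proof (rule vector_eqI)
  fix \<phi> assume "Vector_Spaces.linear scale (*) \<phi>"
  then interpret \<phi>: Vector_Spaces.linear scale "(*)" \<phi> .
  define p where "p = (\<Sum>i\<le>n. monom (\<phi> (a i)) i)"
  have "poly p s = 0" for s
    using arg_cong[OF zero[of s], of \<phi>]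
    by (simp add: p_def poly_sum poly_monom \<phi>.sum \<phi>.scale mult.commute)
  then have "{s. poly p s = 0} = UNIV" by simp
  then have "p = 0"
    using inf poly_roots_finite[of p] by auto
  then have "coeff p i = 0" by simp
  then show "\<phi> (a i) = \<phi> 0"
    using i by (simp add: p_def coeff_sum)
qed

end

section \<open>Homogeneous parts of the identity at an idempotent\<close>

context comm_nonassoc_algebra
begin

lemma mult_add_right: "mul z (x + y) = mul z x + mul z y"
  by (metis mult_commute mult_add_left)

lemma mult_scale_right: "mul x (scale c y) = scale c (mul x y)"
  by (metis mult_commute mult_scale_left)

lemma mult_zero_left: "mul 0 x = 0"
  using mult_add_left[of 0 0 x] by simp

lemma mult_zero_right: "mul x 0 = 0"
  by (simp add: mult_commute[of x] mult_zero_left)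

lemma mult_diff_right: "mul z (x - y) = mul z x - mul z y"
  by (metis add_diff_cancel diff_add_cancel mult_add_right)

lemmas mult_expand = mult_add_left mult_add_right mult_scale_left mult_scale_right
  mult_zero_left mult_zero_right

end

text \<open>On elements of weight one the degree-six identity reads \<open>2 x\<^sup>2 x\<^sup>4 = x\<^sup>4 + x\<^sup>2\<close>. All elements \<open>e + s y\<close>
  with \<open>\<omega>(y) = 0\<close> have weight one, and the field is infinite to allow comparing coefficients of \<open>s\<close>.\<close>

locale sextic_train_algebra = comm_baric_algebra scale mul \<omega>
  for scale :: "'k::field \<Rightarrow> 'a::ab_group_add \<Rightarrow> 'a" and mul :: "'a \<Rightarrow> 'a \<Rightarrow> 'a"
    and \<omega> :: "'a \<Rightarrow> 'k" +
  fixes e :: 'a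
  assumes infinite_field: "infinite (UNIV :: 'k set)"
    and train: "\<omega> x = 1 \<Longrightarrow>
      scale 2 (mul (mul x x) (mul x (mul x (mul x x)))) = mul x (mul x (mul x x)) + mul x x"
    and idem: "mul e e = e"
    and weight_idem: "\<omega> e = 1"
begin

sublocale \<omega>: Vector_Spaces.linear scale "(*)" \<omega>
  by (fact weight_linear)

text \<open>The coefficients of \<open>s, s\<^sup>2, s\<^sup>3, s\<^sup>4\<close> in the principal power \<open>(e + s y)\<^sup>4\<close>. Keeping them as opaque
  constants keeps the expansion of \<open>x\<^sup>2 x\<^sup>4\<close> short.\<close>

definition fourth1 :: "'a \<Rightarrow> 'a" where
  "fourth1 y = mul e y + mul e (mul e y) + scale 2 (mul e (mul e (mul e y)))"

definition fourth2 :: "'a \<Rightarrow> 'a" where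
  "fourth2 y = mul e (mul e (mul y y)) + scale 2 (mul e (mul y (mul e y)))
     + mul y (mul e y + scale 2 (mul e (mul e y)))"

definition fourth3 :: "'a \<Rightarrow> 'a" where
  "fourth3 y = mul e (mul y (mul y y)) + mul y (mul e (mul y y))
     + scale 2 (mul y (mul y (mul e y)))"

definition fourth4 :: "'a \<Rightarrow> 'a" where
  "fourth4 y = mul y (mul y (mul y y))"

lemma square_expansion:
  "mul (e + scale s y) (e + scale s y) = e + scale s (scale 2 (mul e y)) + scale (s^2) (mul y y)"
proof (rule vector_eqI)
  fix \<phi> assume "Vector_Spaces.linear scale (*) \<phi>"
  then interpret \<phi>: Vector_Spaces.linear scale "(*)" \<phi> .
  show "\<phi> (mul (e + scale s y) (e + scale s y)) =
      \<phi> (e + scale s (scale 2 (mul e y)) + scale (s^2) (mul y y))"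
    by (simp add: mult_expand idem mult_commute[of y e] mult_commute[of "mul y y" e] \<phi>.add \<phi>.scale \<phi>.diff \<phi>.neg) algebra
qed

lemma fourth_power_expansion:
  fixes s y defines "x \<equiv> e + scale s y"
  shows "mul x (mul x (mul x x)) =
    e + scale s (fourth1 y) + scale (s^2) (fourth2 y) + scale (s^3) (fourth3 y)
      + scale (s^4) (fourth4 y)"
proof (rule vector_eqI)
  fix \<phi> assume "Vector_Spaces.linear scale (*) \<phi>"
  then interpret \<phi>: Vector_Spaces.linear scale "(*)" \<phi> .
  show "\<phi> (mul x (mul x (mul x x))) = \<phi> (e + scale s (fourth1 y) + scale (s^2) (fourth2 y)
      + scale (s^3) (fourth3 y) + scale (s^4) (fourth4 y))"
    unfolding x_def square_expansion fourth1_def fourth2_def fourth3_def fourth4_def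
    by (simp add: mult_expand idem mult_commute[of y e] mult_commute[of "mul y y" e] \<phi>.add \<phi>.scale \<phi>.diff \<phi>.neg) algebra
qed

text \<open>These are the coefficients of \<open>s\<^sup>2\<close> and \<open>s\<^sup>3\<close> in \<open>2 x\<^sup>2 x\<^sup>4 = x\<^sup>4 + x\<^sup>2\<close> for \<open>x = e + s y\<close>, which has
  weight one for every \<open>s\<close>. Here \<open>x\<^sup>2\<close> contributes at most degree two, so only the lower
  coefficients of \<open>x\<^sup>4\<close> enter.\<close>

lemma homogeneous_parts:
  assumes y: "\<omega> y = 0"
  shows "scale 2 (mul e (fourth2 y) + scale 2 (mul (mul e y) (fourth1 y)) + mul e (mul y y))
           = fourth2 y + mul y y" (is ?quadratic)
    and "scale 2 (mul e (fourth3 y) + scale 2 (mul (mul e y) (fourth2 y))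
           + mul (mul y y) (fourth1 y)) = fourth3 y" (is ?cubic)
proof -
  \<comment> \<open>the coefficients of \<open>2 x\<^sup>2 x\<^sup>4 - x\<^sup>4 - x\<^sup>2\<close> by degree; degree \<open>0\<close>
    vanishes because \<open>e\<close> is idempotent\<close>
  define c :: "nat \<Rightarrow> 'a" where "c = (\<lambda>n. [
    0,
    scale 2 (mul e (fourth1 y) + scale 2 (mul e (mul e y))) - fourth1 y - scale 2 (mul e y),
    scale 2 (mul e (fourth2 y) + scale 2 (mul (mul e y) (fourth1 y)) + mul e (mul y y))
      - fourth2 y - mul y y,
    scale 2 (mul e (fourth3 y) + scale 2 (mul (mul e y) (fourth2 y)) + mul (mul y y) (fourth1 y))
      - fourth3 y,
    scale 2 (mul e (fourth4 y) + scale 2 (mul (mul e y) (fourth3 y)) + mul (mul y y) (fourth2 y))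
      - fourth4 y,
    scale 2 (scale 2 (mul (mul e y) (fourth4 y)) + mul (mul y y) (fourth3 y)),
    scale 2 (mul (mul y y) (fourth4 y))] ! n)"
  have "(\<Sum>i\<le>6. scale (s ^ i) (c i)) = 0" for s
  proof (rule vector_eqI)
    fix \<phi> assume "Vector_Spaces.linear scale (*) \<phi>"
    then interpret \<phi>: Vector_Spaces.linear scale "(*)" \<phi> .
    have "\<omega> (e + scale s y) = 1"
      by (simp add: \<omega>.add \<omega>.scale weight_idem y)
    note arg_cong[OF train[OF this], of \<phi>]
    note equation = this[unfolded fourth_power_expansion, unfolded square_expansion]
    have sum: "(\<Sum>i\<le>6. scale (s ^ i) (c i)) = c 0 + scale s (c 1) + scale (s^2) (c 2)
      + scale (s^3) (c 3) + scale (s^4) (c 4) + scale (s^5) (c 5) + scale (s^6) (c 6)"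
      by (simp add: eval_nat_numeral add.assoc)
    show "\<phi> (\<Sum>i\<le>6. scale (s ^ i) (c i)) = \<phi> 0"
      unfolding sum using equation
      unfolding c_def
      by (simp add: mult_expand idem mult_commute[of y e] mult_commute[of "mul y y" e]
          mult_commute[of "mul e y" e] \<phi>.add \<phi>.scale \<phi>.diff) algebra
  qed
  from coefficients_vanish[OF infinite_field this]
  have c: "c 2 = 0" "c 3 = 0" by simp_all
  show ?quadratic ?cubic
    using c by (simp_all add: c_def diff_eq_eq add.commute add.left_commute)
qed

end


section \<open>Products of Peirce components\<close>

text \<open>The assumptions \<open>root_zero\<close> and \<open>root_double\<close> cover characteristics \<open>3\<close> and \<open>23\<close>: there the
  Peirce space of \<open>\<mu>\<close> may coincide with one that is assumed to be zero, while the scalars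
  \<open>\<mu>\<close> and \<open>4 \<mu> + 1\<close> that would have to be cancelled may vanish.\<close>

locale two_peirce_train_algebra = sextic_train_algebra scale mul \<omega> e
  for scale :: "'k::field \<Rightarrow> 'a::ab_group_add \<Rightarrow> 'a" and mul :: "'a \<Rightarrow> 'a \<Rightarrow> 'a"
    and \<omega> :: "'a \<Rightarrow> 'k" and e :: 'a +
  fixes \<mu> :: 'k
  assumes two: "(2::'k) \<noteq> 0" and one_six_three: "(163::'k) \<noteq> 0"
    and root: "2 * \<mu>^2 + \<mu> + 3 = 0"
    and root_zero: "\<mu> = 0 \<Longrightarrow> peirce_space scale mul \<omega> e \<mu> = {0}"
    and root_double: "4 * \<mu> + 1 = 0 \<Longrightarrow> peirce_space scale mul \<omega> e \<mu> = {0}"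
    and decomposition: "\<omega> y = 0 \<Longrightarrow>
      \<exists>a\<in>peirce_space scale mul \<omega> e (1/2). \<exists>b\<in>peirce_space scale mul \<omega> e \<mu>. y = a + b"
begin

abbreviation H :: "'a set" where "H \<equiv> peirce_space scale mul \<omega> e (1/2)"
abbreviation M :: "'a set" where "M \<equiv> peirce_space scale mul \<omega> e \<mu>"

text \<open>As an opaque constant subject to \<open>2 h = 1\<close>, the eigenvalue \<open>1/2\<close> enters polynomial identities
  without a division, so that a single polynomial identity serves every characteristic other than \<open>2\<close>.\<close>

definition h :: 'k where "h = 1/2"

lemma two_h: "2 * h = 1"
  using two by (simp add: h_def)

lemma halfD: "u \<in> H \<Longrightarrow> mul e u = scale h u" "u \<in> H \<Longrightarrow> \<omega> u = 0"
  by (simp_all add: peirce_space_def h_def)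

lemma rootD: "v \<in> M \<Longrightarrow> mul e v = scale \<mu> v" "v \<in> M \<Longrightarrow> \<omega> v = 0"
  by (simp_all add: peirce_space_def)

lemma nondegenerate:
  assumes "v \<in> M" "v \<noteq> 0"
  shows "\<mu> \<noteq> 0" "4 * \<mu> + 1 \<noteq> 0"
  using root_zero root_double assms by auto

lemma zero_mem: "0 \<in> H"
  by (simp_all add: peirce_space_def mult_expand)

lemma scale_mem: "v \<in> M \<Longrightarrow> scale c v \<in> M"
  by (simp_all add: peirce_space_def mult_expand \<omega>.scale mult.commute)

lemma four: "(4::'k) \<noteq> 0"
  using two mult_eq_0_iff[of "2::'k" 2] by simp

lemma root_ne_half: "2 * \<mu> - 1 \<noteq> 0"
proof
  assume "2 * \<mu> - 1 = 0"
  moreover have "4 = (2 * \<mu>^2 + \<mu> + 3) - (2 * \<mu> - 1) * (\<mu> + 1)" by algebra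
  ultimately show False using root four by simp
qed

text \<open>Eigenvectors of the multiplication by \<open>e\<close> for the distinct eigenvalues \<open>1/2\<close> and \<open>\<mu>\<close> are
  independent, so an equation between Peirce components splits into two.\<close>

lemma peirce_independent:
  assumes u: "u \<in> H" and v: "v \<in> M" and sum: "scale \<alpha> u + scale \<beta> v = 0"
  shows "scale \<alpha> u = 0" "scale \<beta> v = 0"
proof -
  define a b where ab: "a = scale \<alpha> u" "b = scale \<beta> v"
  have e: "mul e a = scale h a" "mul e b = scale \<mu> b"
    using u v by (simp_all add: ab mult_expand halfD rootD mult.commute)
  have a: "a = - b"
    using sum by (simp add: ab eq_neg_iff_add_eq_0)
  have "scale (2 * \<mu> - 1) b = 0"
  proof (rule vector_eqI)
    fix \<phi> assume "Vector_Spaces.linear scale (*) \<phi>"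
    then interpret \<phi>: Vector_Spaces.linear scale "(*)" \<phi> .
    have "mul e a + mul e b = 0"
      using mult_add_right[of e a b] a by (simp add: mult_expand)
    from arg_cong[OF this, of \<phi>] have "h * \<phi> a + \<mu> * \<phi> b = 0"
      by (simp add: e \<phi>.add \<phi>.scale)
    moreover have "\<phi> a = - \<phi> b" using a \<phi>.neg by simp
    ultimately have "(2 * \<mu> - 1) * \<phi> b = 0" using two_h by algebra
    then show "\<phi> (scale (2 * \<mu> - 1) b) = \<phi> 0" by (simp only: \<phi>.scale \<phi>.zero)
  qed
  then have "b = 0" using root_ne_half by simp
  then show "scale \<alpha> u = 0" "scale \<beta> v = 0"
    using a by (simp_all add: ab)
qed

text \<open>The quadratic part at \<open>y = u\<close> applies the polynomial \<open>t (2 t\<^sup>2 + t + 3)\<close> in the multiplication by \<open>e\<close>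
  to \<open>u\<^sup>2\<close>. It kills the component in \<open>M\<close> and multiplies the one in \<open>H\<close> by \<open>2\<close>.\<close>

lemma square_half:
  assumes u: "u \<in> H"
  shows "mul u u \<in> M"
proof -
  have "\<omega> (mul u u) = 0" using u by (simp add: weight_mult halfD)
  then obtain a b where ab: "a \<in> H" "b \<in> M" "mul u u = a + b"
    using decomposition by blast
  have "scale 2 a = 0"
  proof (rule vector_eqI)
    fix \<phi> assume "Vector_Spaces.linear scale (*) \<phi>"
    then interpret \<phi>: Vector_Spaces.linear scale "(*)" \<phi> .
    from arg_cong[OF homogeneous_parts(1)[of u], of \<phi>] u
    have "\<phi> (scale 2 (mul e (fourth2 u) + scale 2 (mul (mul e u) (fourth1 u)) + mul e (mul u u)))
           = \<phi> (fourth2 u + mul u u)" by (simp add: halfD)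
    then show "\<phi> (scale 2 a) = \<phi> 0"
      unfolding fourth1_def fourth2_def using two_h root
      by (simp add: mult_expand halfD rootD u ab \<phi>.add \<phi>.scale \<phi>.diff \<phi>.neg) algebra
  qed
  then show ?thesis using two ab by simp
qed

text \<open>Polarisation of \<open>u\<^sup>2 \<in> M\<close>; it is needed for the product of \<open>u\<close> with \<open>u v\<close>, another element of \<open>H\<close>.\<close>

lemma prod_half:
  assumes u: "u \<in> H" and v: "v \<in> H"
  shows "mul u v \<in> M"
proof -
  have "u + v \<in> H" using assms
    by (simp add: peirce_space_def mult_expand \<omega>.add scale_right_distrib)
  then have sq: "mul (u + v) (u + v) \<in> M" "mul u u \<in> M" "mul v v \<in> M"
    using assms square_half by blast+
  have "mul u v + mul u v = mul (u + v) (u + v) - mul u u - mul v v"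
    by (simp add: mult_expand mult_commute[of v u])
  then have "scale (1 + 1) (mul u v) = mul (u + v) (u + v) - mul u u - mul v v"
    by (simp only: scale_left_distrib scale_one)
  also have "\<dots> \<in> M"
    using sq by (simp add: peirce_space_def \<omega>.diff mult_diff_right scale_right_diff_distrib)
  finally have "scale h (scale 2 (mul u v)) \<in> M" by (intro scale_mem[of _ h]) simp
  then show ?thesis using two_h by (simp add: mult.commute[of h])
qed

text \<open>The quadratic part at \<open>y = v\<close> multiplies the components of \<open>v\<^sup>2\<close> by \<open>- 8 \<mu>\<^sup>2\<close> and \<open>23 - 6 \<mu>\<close>. The
  second scalar vanishes for a root of \<open>2 t\<^sup>2 + t + 3\<close> only if \<open>4 \<cdot> 163 = 0\<close>; this is where
  characteristic \<open>163\<close> is excluded.\<close>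

lemma square_root:
  assumes v: "v \<in> M"
  shows "mul v v = 0"
proof (cases "v = 0")
  case True
  then show ?thesis by (simp add: mult_expand)
next
  case False
  have "\<omega> (mul v v) = 0" using v by (simp add: weight_mult rootD)
  then obtain a b where ab: "a \<in> H" "b \<in> M" "mul v v = a + b"
    using decomposition by blast
  have "scale (- 8 * \<mu>^2) a + scale (23 - 6 * \<mu>) b = 0"
  proof (rule vector_eqI)
    fix \<phi> assume "Vector_Spaces.linear scale (*) \<phi>"
    then interpret \<phi>: Vector_Spaces.linear scale "(*)" \<phi> .
    from arg_cong[OF homogeneous_parts(1)[of v], of \<phi>] v
    have "\<phi> (scale 2 (mul e (fourth2 v) + scale 2 (mul (mul e v) (fourth1 v)) + mul e (mul v v)))
           = \<phi> (fourth2 v + mul v v)" by (simp add: rootD)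
    then show "\<phi> (scale (- 8 * \<mu>^2) a + scale (23 - 6 * \<mu>) b) = \<phi> 0"
      unfolding fourth1_def fourth2_def using two_h root
      by (simp add: mult_expand halfD rootD v ab \<phi>.add \<phi>.scale \<phi>.diff \<phi>.neg) algebra
  qed
  from peirce_independent[OF ab(1,2) this]
  have "- 8 * \<mu>^2 = 0 \<or> a = 0" "23 - 6 * \<mu> = 0 \<or> b = 0" by (metis scale_eq_0_iff)+
  moreover have "(8::'k) \<noteq> 0"
    using mult_eq_0_iff[of "2::'k" 4] two four by simp
  moreover have "\<mu> \<noteq> 0" using nondegenerate v False by blast
  moreover have "23 - 6 * \<mu> \<noteq> 0"
  proof
    assume "23 - 6 * \<mu> = 0"
    moreover have "4 * 163 = 18 * (2 * \<mu>^2 + \<mu> + 3) + (23 - 6 * \<mu>) * (6 * \<mu> + 26)" by algebra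
    ultimately show False using root four one_six_three by (metis add_0 mult_eq_0_iff)
  qed
  ultimately show ?thesis using ab by simp
qed

lemma prod_root:
  assumes "v \<in> M" "w \<in> M"
  shows "mul v w = 0"
proof -
  have "v + w \<in> M" using assms
    by (simp add: peirce_space_def mult_expand \<omega>.add scale_right_distrib)
  then have "mul v w + mul v w = 0"
    using square_root[of "v + w"] square_root[of v] square_root[of w] assms
    by (simp add: mult_expand mult_commute[of w v])
  then have "scale 2 (mul v w) = 0"
    by (metis one_add_one scale_left_distrib scale_one)
  then show ?thesis using two by simp
qed

text \<open>In the quadratic part at \<open>y = u + v\<close> the squares of \<open>u\<close> and \<open>v\<close> drop out, and \<open>u v\<close> is acted on by
  \<open>t (2 t - 1) (2 t + 1 + 2 \<mu>)\<close>. The component in \<open>H\<close> is unconstrained, the one in \<open>M\<close> is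
  multiplied by the value at \<open>t = \<mu>\<close>.\<close>

lemma prod_half_root:
  assumes u: "u \<in> H" and v: "v \<in> M"
  shows "mul u v \<in> H"
proof (cases "v = 0")
  case True
  then show ?thesis by (simp add: mult_expand zero_mem)
next
  case False
  have "\<omega> (mul u v) = 0" using v by (simp add: weight_mult rootD)
  then obtain a b where ab: "a \<in> H" "b \<in> M" "mul u v = a + b" "mul v u = a + b"
    using decomposition mult_commute by metis
  define w where "w = mul u u"
  have w: "w \<in> M" "mul u u = w" using square_half[OF u] by (simp_all add: w_def)
  have "scale (\<mu> * (2 * \<mu> - 1) * (4 * \<mu> + 1)) b = 0"
  proof (rule vector_eqI)
    fix \<phi> assume "Vector_Spaces.linear scale (*) \<phi>"
    then interpret \<phi>: Vector_Spaces.linear scale "(*)" \<phi> .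
    have "\<omega> (u + v) = 0" using u v by (simp add: \<omega>.add halfD rootD)
    from arg_cong[OF homogeneous_parts(1)[OF this], of \<phi>]
    show "\<phi> (scale (\<mu> * (2 * \<mu> - 1) * (4 * \<mu> + 1)) b) = \<phi> 0"
      unfolding fourth1_def fourth2_def using two_h root
      by (simp add: mult_expand halfD rootD u v ab w square_root \<phi>.add \<phi>.scale \<phi>.diff \<phi>.neg) algebra
  qed
  then have "b = 0"
    using nondegenerate[OF v False] root_ne_half by simp
  then show ?thesis using ab by simp
qed

text \<open>Since \<open>u\<^sup>2 \<in> M\<close>, the vector \<open>u u\<^sup>2\<close> lies in \<open>H\<close>, and the cubic part at \<open>y = u\<close> becomes
  \<open>2 (2 + \<mu> + \<mu>\<^sup>2) u u\<^sup>2 = 0\<close>, whose scalar equals \<open>\<mu> + 1\<close>.\<close>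

lemma cube_half:
  assumes u: "u \<in> H"
  shows "mul u (mul u u) = 0"
proof -
  define w where "w = mul u u"
  have w: "w \<in> M" "mul u u = w" using square_half[OF u] by (simp_all add: w_def)
  define g where "g = mul u w"
  have g: "g \<in> H" "mul u w = g" "mul w u = g"
    using prod_half_root[OF u w(1)] by (simp_all add: g_def mult_commute)
  have "scale (\<mu> + 1) g = 0"
  proof (rule vector_eqI)
    fix \<phi> assume "Vector_Spaces.linear scale (*) \<phi>"
    then interpret \<phi>: Vector_Spaces.linear scale "(*)" \<phi> .
    from arg_cong[OF homogeneous_parts(2)[OF halfD(2)[OF u]], of \<phi>]
    show "\<phi> (scale (\<mu> + 1) g) = \<phi> 0"
      unfolding fourth1_def fourth2_def fourth3_def using two_h root
      by (simp add: mult_expand halfD rootD u w g \<phi>.add \<phi>.scale \<phi>.diff \<phi>.neg) algebra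
  qed
  moreover have "\<mu> + 1 \<noteq> 0"
  proof
    assume "\<mu> + 1 = 0"
    moreover have "4 = (2 * \<mu>^2 + \<mu> + 3) - (2 * \<mu> - 1) * (\<mu> + 1)" by algebra
    ultimately show False using root four by simp
  qed
  ultimately show ?thesis by (simp add: w g)
qed

text \<open>The cubic part at \<open>y = u + v\<close> has contributions of type \<open>(1,2)\<close> in \<open>(u, v)\<close>, which are multiples of
  \<open>v (u v) \<in> H\<close>, and of type \<open>(2,1)\<close>, multiples of \<open>u (u v) \<in> M\<close>; those of pure type vanish by the
  previous results. The two types land in different Peirce spaces, which separates them.\<close>

lemma mixed_cubes:
  assumes u: "u \<in> H" and v: "v \<in> M"
  shows "mul u (mul u v) = 0" "mul v (mul u v) = 0"
proof -
  have "mul u (mul u v) = 0 \<and> mul v (mul u v) = 0"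
  proof (cases "v = 0")
    case True
    then show ?thesis by (simp add: mult_expand)
  next
    case False
    define w where "w = mul u u"
    have w: "w \<in> M" "mul u u = w" "mul u w = 0" "mul w u = 0"
      using square_half[OF u] cube_half[OF u] mult_commute[of w u] by (simp_all add: w_def)
    have vw: "mul v w = 0" "mul w v = 0" "mul v v = 0"
      using prod_root v w by simp_all
    define z where "z = mul u v"
    have z: "z \<in> H" "mul u v = z" "mul v u = z"
      using prod_half_root[OF u v] by (simp_all add: z_def mult_commute)
    define g where "g = mul v z"
    have g: "g \<in> H" "mul v z = g" "mul z v = g"
      using prod_half_root[OF z(1) v] by (simp_all add: g_def mult_commute)
    define t where "t = mul u z"
    have t: "mul u z = t" "mul z u = t"
      by (simp_all add: t_def mult_commute)
    have "t \<in> M" using prod_half[OF u z(1)] by (simp add: t_def)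
    have "scale (4 * \<mu> * (\<mu> - 3)) g + scale (- 2 * (\<mu> + 6)) t = 0"
    proof (rule vector_eqI)
      fix \<phi> assume "Vector_Spaces.linear scale (*) \<phi>"
      then interpret \<phi>: Vector_Spaces.linear scale "(*)" \<phi> .
      have "\<omega> (u + v) = 0" using u v by (simp add: \<omega>.add halfD rootD)
      from arg_cong[OF homogeneous_parts(2)[OF this], of \<phi>]
      show "\<phi> (scale (4 * \<mu> * (\<mu> - 3)) g + scale (- 2 * (\<mu> + 6)) t) = \<phi> 0"
        unfolding fourth1_def fourth2_def fourth3_def using two_h root
        by (simp add: mult_expand halfD rootD u v w vw z g t \<open>t \<in> M\<close> \<phi>.add \<phi>.scale \<phi>.diff \<phi>.neg) algebra
    qed
    from peirce_independent[OF g(1) \<open>t \<in> M\<close> this]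
    have "4 * \<mu> * (\<mu> - 3) = 0 \<or> g = 0" "(2::'k) = 0 \<or> \<mu> + 6 = 0 \<or> t = 0"
      by (metis scale_eq_0_iff mult_eq_0_iff neg_equal_0_iff_equal)+
    moreover note nz = nondegenerate[OF v False]
    moreover have "\<mu> - 3 \<noteq> 0"
    proof
      assume "\<mu> - 3 = 0"
      moreover have "4 * 2 * \<mu> = (2 * \<mu>^2 + \<mu> + 3) - (2 * \<mu> - 1) * (\<mu> - 3)" by algebra
      ultimately show False using root nz two four by (metis diff_0_right mult_eq_0_iff)
    qed
    moreover have "\<mu> + 6 \<noteq> 0"
    proof
      assume "\<mu> + 6 = 0"
      moreover have "\<mu> * (4 * \<mu> + 1) * 2 = 4 * (2 * \<mu>^2 + \<mu> + 3) - 2 * (\<mu> + 6)" by algebra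
      ultimately show False using root nz two by (metis diff_0_right mult_eq_0_iff)
    qed
    ultimately show ?thesis using two four by (simp add: z g t)
  qed
  then show "mul u (mul u v) = 0" "mul v (mul u v) = 0" by simp_all
qed

text \<open>Once the cubic products vanish, only the coefficients of \<open>e\<close>, \<open>u\<close>, \<open>v\<close>, \<open>u\<^sup>2\<close> and \<open>u v\<close> are left. They
  cancel because multiplication by \<open>e\<close> has eigenvalue \<open>1/2\<close> on \<open>u\<close> and \<open>u v\<close>, and \<open>\<mu>\<close> on \<open>v\<close> and
  \<open>u\<^sup>2\<close>. The weight \<open>c\<close> is carried along as an indeterminate, so weight zero is included.\<close>

theorem principal_train_equation:
  "mul x (mul x x) - scale ((1 + \<mu>) * \<omega> x) (mul x x) + scale (\<mu> * \<omega> x ^ 2) x = 0"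
proof -
  define c where "c = \<omega> x"
  have "\<omega> (x - scale c e) = 0"
    by (simp add: c_def \<omega>.diff \<omega>.scale weight_idem)
  then obtain u v where u: "u \<in> H" and v: "v \<in> M" and "x - scale c e = u + v"
    using decomposition by blast
  then have x: "x = scale c e + (u + v)" by (simp add: algebra_simps)
  define w where "w = mul u u"
  have w: "w \<in> M" "mul u u = w" "mul u w = 0" "mul v w = 0"
    using square_half[OF u] cube_half[OF u] prod_root[OF v] by (simp_all add: w_def)
  define z where "z = mul u v"
  have z: "z \<in> H" "mul u v = z" "mul v u = z" "mul u z = 0" "mul v z = 0"
    using prod_half_root[OF u v] mixed_cubes[OF u v] by (simp_all add: z_def mult_commute)
  have e: "mul u e = scale h u" "mul v e = scale \<mu> v"
    using u v mult_commute[of _ e] by (simp_all add: halfD rootD)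
  have "mul x (mul x x) - scale ((1 + \<mu>) * c) (mul x x) + scale (\<mu> * c ^ 2) x = 0"
  proof (rule vector_eqI)
    fix \<phi> assume "Vector_Spaces.linear scale (*) \<phi>"
    then interpret \<phi>: Vector_Spaces.linear scale "(*)" \<phi> .
    show "\<phi> (mul x (mul x x) - scale ((1 + \<mu>) * c) (mul x x) + scale (\<mu> * c ^ 2) x) = \<phi> 0"
      unfolding x using two_h root
      by (simp add: mult_expand halfD rootD idem u v w z e square_root \<phi>.add \<phi>.scale \<phi>.diff)
        algebra
  qed
  then show ?thesis by (simp add: c_def)
qed

end

section \<open>The two surviving Peirce roots\<close>

lemma CHAR_eq_prime_if_of_nat_zero:
  assumes "prime p" "of_nat p = (0 :: 'k::field)"
  shows "CHAR('k) = p"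
proof -
  have "CHAR('k) dvd p" using assms(2) by (simp add: of_nat_eq_0_iff_char_dvd)
  moreover have "CHAR('k) \<noteq> 1"
    using of_nat_CHAR[where 'a = 'k] by auto
  ultimately show ?thesis using assms(1) by (auto simp: prime_nat_iff)
qed

lemma peirce_lambda_root:
  fixes r :: "'k::field"
  assumes r: "r ^ 2 = - 23" and two: "(2::'k) \<noteq> 0"
  shows "2 * peirce_lambda r ^ 2 + peirce_lambda r + 3 = 0"
proof -
  have four: "(4::'k) \<noteq> 0" and eight: "(8::'k) \<noteq> 0"
    using two mult_eq_0_iff[of "2::'k" 2] mult_eq_0_iff[of "2::'k" 4] by simp_all
  have "4 * peirce_lambda r = - 1 - r"
    using four by (simp add: peirce_lambda_def)
  then have "8 * (2 * peirce_lambda r ^ 2 + peirce_lambda r + 3) = 0"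
    using r by algebra
  then show ?thesis using eight by (metis mult_eq_0_iff)
qed

text \<open>Conjugation is a change of the chosen square root of \<open>- 23\<close>, so facts on \<open>\<lambda>\<close> transfer.\<close>

lemma peirce_lambda_uminus: "peirce_lambda (- r) = peirce_lambda_bar r"
  by (simp add: peirce_lambda_def peirce_lambda_bar_def)

theorem proposition5p2:
  fixes scale :: "'k::alg_closed_field \<Rightarrow> 'a::ab_group_add \<Rightarrow> 'a"
    and mul :: "'a \<Rightarrow> 'a \<Rightarrow> 'a"
    and \<omega> :: "'a \<Rightarrow> 'k"
    and e :: 'a
    and r :: 'k
  assumes char: "CHAR('k) \<noteq> 2" "CHAR('k) \<noteq> 163"
    and root: "r ^ 2 = - 23"
    and baric: "comm_baric_algebra scale mul \<omega>"
    and identity: "\<And>x. scale 2 (mul (ppow mul x 2) (ppow mul x 4)) =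
        scale (\<omega> x ^ 2) (ppow mul x 4) + scale (\<omega> x ^ 4) (ppow mul x 2)"
    and idempotent: "mul e e = e" "e \<noteq> 0"
    and peirce: "internal_direct_sum
        [module.span scale {e},
         peirce_space scale mul \<omega> e 0,
         peirce_space scale mul \<omega> e (1 / 2),
         peirce_space scale mul \<omega> e (peirce_lambda r),
         peirce_space scale mul \<omega> e (peirce_lambda_bar r)]"
  shows "(peirce_space scale mul \<omega> e 0 = {0} \<and>
          peirce_space scale mul \<omega> e (peirce_lambda_bar r) = {0} \<longrightarrow>
          (\<forall>x. ppow mul x 3 - scale ((1 + peirce_lambda r) * \<omega> x) (ppow mul x 2)
               + scale (peirce_lambda r * \<omega> x ^ 2) x = 0)) \<and>
         (peirce_space scale mul \<omega> e 0 = {0} \<and>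
          peirce_space scale mul \<omega> e (peirce_lambda r) = {0} \<longrightarrow>
          (\<forall>x. ppow mul x 3 - scale ((1 + peirce_lambda_bar r) * \<omega> x) (ppow mul x 2)
               + scale (peirce_lambda_bar r * \<omega> x ^ 2) x = 0))"
proof -
  interpret comm_baric_algebra scale mul \<omega> by (fact baric)
  interpret \<omega>: Vector_Spaces.linear scale "(*)" \<omega> by (fact weight_linear)
  have "prime (2::nat)" "prime (163::nat)"
    by simp_all
  then have two: "(2::'k) \<noteq> 0" and one_six_three: "(163::'k) \<noteq> 0"
    using CHAR_eq_prime_if_of_nat_zero[where 'k = 'k] char by fastforce+
  have train: "scale 2 (mul (mul x x) (mul x (mul x (mul x x)))) =
      scale (\<omega> x ^ 2) (mul x (mul x (mul x x))) + scale (\<omega> x ^ 4) (mul x x)" for x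
    using identity[of x] by (simp add: eval_nat_numeral)
  have weight: "\<omega> e = 1"
  proof (rule ccontr)
    assume "\<omega> e \<noteq> 1"
    moreover have "\<omega> e * \<omega> e = \<omega> e" using weight_mult[of e e] idempotent by simp
    ultimately have "\<omega> e = 0" by simp
    then have "scale 2 e = 0" using train[of e] idempotent by simp
    then show False using two idempotent by simp
  qed
  \<comment> \<open>Both cases are instances of this, with \<open>\<mu>\<close> the surviving root.\<close>
  have key: "ppow mul x 3 - scale ((1 + \<mu>) * \<omega> x) (ppow mul x 2) + scale (\<mu> * \<omega> x ^ 2) x = 0"
    if root: "2 * \<mu>^2 + \<mu> + 3 = 0"
      and zero: "peirce_space scale mul \<omega> e 0 = {0}"
      and double: "4 * \<mu> + 1 = 0 \<Longrightarrow> peirce_space scale mul \<omega> e \<mu> = {0}"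
      and components: "\<And>y. \<exists>c. \<exists>a\<in>peirce_space scale mul \<omega> e (1/2).
        \<exists>b\<in>peirce_space scale mul \<omega> e \<mu>. y = scale c e + a + b"
    for \<mu> x
  proof -
    interpret two_peirce_train_algebra scale mul \<omega> e \<mu>
    proof
      show "infinite (UNIV :: 'k set)" by (rule infinite_UNIV_alg_closed_field)
      show "scale 2 (mul (mul x x) (mul x (mul x (mul x x)))) = mul x (mul x (mul x x)) + mul x x"
        if "\<omega> x = 1" for x
        using train[of x] that by simp
      show "\<exists>a\<in>peirce_space scale mul \<omega> e (1/2). \<exists>b\<in>peirce_space scale mul \<omega> e \<mu>. y = a + b"
        if y: "\<omega> y = 0" for y
      proof -
        obtain c a b where ab: "a \<in> peirce_space scale mul \<omega> e (1/2)"
            "b \<in> peirce_space scale mul \<omega> e \<mu>" "y = scale c e + a + b"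
          using components by blast
        then have "c = 0"
          using y by (simp add: \<omega>.add \<omega>.scale weight peirce_space_def)
        then show ?thesis using ab by auto
      qed
    qed (use idempotent weight two one_six_three root zero double in auto)
    show ?thesis using principal_train_equation[of x] by (simp add: eval_nat_numeral)
  qed
  have decomposition: "\<exists>c. \<exists>a0\<in>peirce_space scale mul \<omega> e 0. \<exists>a\<in>peirce_space scale mul \<omega> e (1/2).
      \<exists>b\<in>peirce_space scale mul \<omega> e (peirce_lambda r).
      \<exists>b'\<in>peirce_space scale mul \<omega> e (peirce_lambda_bar r). y = scale c e + a0 + a + b + b'" for y
  proof -
    obtain xs where "list_all2 (\<lambda>v V. v \<in> V) xs [span {e}, peirce_space scale mul \<omega> e 0,
         peirce_space scale mul \<omega> e (1 / 2), peirce_space scale mul \<omega> e (peirce_lambda r),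
         peirce_space scale mul \<omega> e (peirce_lambda_bar r)]" "sum_list xs = y"
      using peirce unfolding internal_direct_sum_def by metis
    then show ?thesis
      by (fastforce simp: list_all2_Cons2 span_singleton add.assoc)
  qed
  \<comment> \<open>If \<open>r = 0\<close>, the surviving Peirce space is the one assumed to be zero.\<close>
  have double: "4 * peirce_lambda r + 1 = 0 \<longleftrightarrow> r = 0" "4 * peirce_lambda_bar r + 1 = 0 \<longleftrightarrow> r = 0"
    using two mult_eq_0_iff[of "2::'k" 2]
    by (simp_all add: peirce_lambda_def peirce_lambda_bar_def field_simps)
  show ?thesis
  proof (intro conjI impI allI; elim conjE)
    fix x
    assume zero: "peirce_space scale mul \<omega> e 0 = {0}"
      and other: "peirce_space scale mul \<omega> e (peirce_lambda_bar r) = {0}"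
    show "ppow mul x 3 - scale ((1 + peirce_lambda r) * \<omega> x) (ppow mul x 2)
               + scale (peirce_lambda r * \<omega> x ^ 2) x = 0"
    proof (rule key[OF peirce_lambda_root[OF root two] zero])
      show "peirce_space scale mul \<omega> e (peirce_lambda r) = {0}" if "4 * peirce_lambda r + 1 = 0"
      proof -
        have "r = 0" using that double by blast
        then show ?thesis using other by (simp add: peirce_lambda_def peirce_lambda_bar_def)
      qed
      show "\<exists>c. \<exists>a\<in>peirce_space scale mul \<omega> e (1/2).
          \<exists>b\<in>peirce_space scale mul \<omega> e (peirce_lambda r). y = scale c e + a + b" for y
        using decomposition[of y] zero other by simp
    qed
  next
    fix x
    assume zero: "peirce_space scale mul \<omega> e 0 = {0}"
      and other: "peirce_space scale mul \<omega> e (peirce_lambda r) = {0}"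
    show "ppow mul x 3 - scale ((1 + peirce_lambda_bar r) * \<omega> x) (ppow mul x 2)
               + scale (peirce_lambda_bar r * \<omega> x ^ 2) x = 0"
    proof (rule key[OF _ zero])
      show "2 * peirce_lambda_bar r ^ 2 + peirce_lambda_bar r + 3 = 0"
        using peirce_lambda_root[of "- r"] root two by (simp add: peirce_lambda_uminus)
      show "peirce_space scale mul \<omega> e (peirce_lambda_bar r) = {0}"
        if "4 * peirce_lambda_bar r + 1 = 0"
      proof -
        have "r = 0" using that double by blast
        then show ?thesis using other by (simp add: peirce_lambda_def peirce_lambda_bar_def)
      qed
      show "\<exists>c. \<exists>a\<in>peirce_space scale mul \<omega> e (1/2).
          \<exists>b\<in>peirce_space scale mul \<omega> e (peirce_lambda_bar r). y = scale c e + a + b" for y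
        using decomposition[of y] zero other by simp
    qed
  qed
qed

end
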